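(* Let $\mathcal G=(\mathcal V_0,\mathcal E)$ be a finite undirected graph and let $\mathcal V_1,\dots,\mathcal V_m\subseteq\mathcal V_0$ be $m$ vertex sets (not necessarily connected) with $\mathcal V_i\cap\mathcal V_{i'}=\emptyset$ for $i\ne i'$. Write $\mathcal V=\cup_{i=1}^m\mathcal V_i$. Then $$\prod_{i=1}^m\mathcal H(\mathcal V_i)\le\mathcal H(\mathcal V)\le\Big\{\prod_{i=1}^m\mathcal H(\mathcal V_i)\Big\}\times\exp\Big[b(\{\mathcal V_i\}_{i=1}^m)\Big\{2\log\Big(\sum_{i=1}^m|\mathcal V_i|\Big)+\log(2)\Big\}\Big].$$
   Context: A (nonempty) vertex set $\mathcal V\subseteq\mathcal V_0$ is connected under $\mathcal G$ if any two of its vertices are joined by a path of $\mathcal G$ all of whose vertices lie in $\mathcal V$. $d_{\mathcal G}(\boldsymbol v_1,\boldsymbol v_2)$ is the length (number of edges) of a shortest path between two vertices, and $d_{\mathcal G}(\mathcal V_1,\mathcal V_2)=\min_{\boldsymbol v_1\in\mathcal V_1,\boldsymbol v_2\in\mathcal V_2}d_{\mathcal G}(\boldsymbol v_1,\boldsymbol v_2)$. For connected $\mathcal V$, $\mathcal H(\mathcal V)$ is the number of spanning trees of $\mathcal V$ under $\mathcal G$ (spanning trees of the subgraph induced on $\mathcal V$). A general vertex set decomposes uniquely as $\mathcal V=\cup_j\mathcal V_j$ with each $\mathcal V_j$ connected and $d_{\mathcal G}(\mathcal V_j,\mathcal V_{j'})>1$ for $j\ne j'$, and then $\mathcal H(\mathcal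 V)=\prod_j\mathcal H(\mathcal V_j)$. For disjoint vertex sets, $b(\{\mathcal V_i\}_{i=1}^m)=\sum_{i<i'}b(\{\mathcal V_i,\mathcal V_{i'}\})$, where $b(\{\mathcal V_i,\mathcal V_{i'}\})$ is the number of edges of $\mathcal G$ connecting $\mathcal V_i$ and $\mathcal V_{i'}$. *)

theory Defs
  imports Complex_Main "HOL-Library.Extended_Nat"
begin

type_synonym 'a ugraph = "'a set \<times> 'a set set"

abbreviation verts :: "'a ugraph \<Rightarrow> 'a set" where "verts G \<equiv> fst G"
abbreviation edges :: "'a ugraph \<Rightarrow> 'a set set" where "edges G \<equiv> snd G"

definition finite_ugraph :: "'a ugraph \<Rightarrow> bool" where
  "finite_ugraph G \<longleftrightarrow>
     finite (verts G) \<and> edges G \<subseteq> {{u, v} | u v. u \<in> verts G \<and> v \<in> verts G \<and> u \<noteq> v}"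

text \<open>Paths and cycles are lists of distinct vertices; a path of length \<open>k\<close> is a list
  of \<open>k + 1\<close> vertices, and a single vertex is a path of length 0.\<close>

definition is_path :: "'a ugraph \<Rightarrow> 'a \<Rightarrow> 'a list \<Rightarrow> 'a \<Rightarrow> bool" where
  "is_path G u p v \<longleftrightarrow>
     p \<noteq> [] \<and> hd p = u \<and> last p = v \<and> distinct p \<and> set p \<subseteq> verts G \<and>
     successively (\<lambda>x y. {x, y} \<in> edges G) p"

definition is_cycle :: "'a ugraph \<Rightarrow> 'a list \<Rightarrow> bool" where
  "is_cycle G p \<longleftrightarrow> length p \<ge> 3 \<and> is_path G (hd p) p (last p) \<and> {last p, hd p} \<in> edges G"

definition connected_in :: "'a ugraph \<Rightarrow> 'a set \<Rightarrow> bool" where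
  "connected_in G V \<longleftrightarrow>
     V \<noteq> {} \<and> V \<subseteq> verts G \<and> (\<forall>u\<in>V. \<forall>v\<in>V. \<exists>p. is_path G u p v \<and> set p \<subseteq> V)"

text \<open>The distances are \<open>\<infinity>\<close> when there is no connecting path.\<close>

definition gdist :: "'a ugraph \<Rightarrow> 'a \<Rightarrow> 'a \<Rightarrow> enat" where
  "gdist G u v = (INF p\<in>{p. is_path G u p v}. enat (length p - 1))"

definition gsetdist :: "'a ugraph \<Rightarrow> 'a set \<Rightarrow> 'a set \<Rightarrow> enat" where
  "gsetdist G A B = (INF u\<in>A. INF v\<in>B. gdist G u v)"

definition induced :: "'a ugraph \<Rightarrow> 'a set \<Rightarrow> 'a ugraph" where
  "induced G V = (V, {e \<in> edges G. e \<subseteq> V})"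

definition is_tree :: "'a ugraph \<Rightarrow> bool" where
  "is_tree T \<longleftrightarrow> finite_ugraph T \<and> connected_in T (verts T) \<and> (\<nexists>p. is_cycle T p)"

definition spanning_trees :: "'a ugraph \<Rightarrow> 'a ugraph set" where
  "spanning_trees G = {T. is_tree T \<and> verts T = verts G \<and> edges T \<subseteq> edges G}"

definition is_decomposition :: "'a ugraph \<Rightarrow> 'a set \<Rightarrow> 'a set set \<Rightarrow> bool" where
  "is_decomposition G V P \<longleftrightarrow>
     \<Union> P = V \<and> (\<forall>A\<in>P. connected_in G A) \<and> (\<forall>A\<in>P. \<forall>B\<in>P. A \<noteq> B \<longrightarrow> gsetdist G A B > 1)"

text \<open>Existence and uniqueness are shown in \<open>ex1_decomposition\<close> below.\<close>

definition decomposition :: "'a ugraph \<Rightarrow> 'a set \<Rightarrow> 'a set set" where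
  "decomposition G V = (THE P. is_decomposition G V P)"

text \<open>For connected \<open>V\<close> the decomposition is \<open>{V}\<close> and this is the number of spanning trees of
  the induced subgraph; for empty \<open>V\<close> it is the empty product 1.\<close>

definition H :: "'a ugraph \<Rightarrow> 'a set \<Rightarrow> nat" where
  "H G V = (\<Prod>C\<in>decomposition G V. card (spanning_trees (induced G C)))"

definition edges_between :: "'a ugraph \<Rightarrow> 'a set \<Rightarrow> 'a set \<Rightarrow> nat" where
  "edges_between G A B = card {e \<in> edges G. \<exists>u\<in>A. \<exists>v\<in>B. e = {u, v}}"

definition b :: "'a ugraph \<Rightarrow> nat \<Rightarrow> (nat \<Rightarrow> 'a set) \<Rightarrow> nat" where
  "b G m V = (\<Sum>(i, j)\<in>{(i, j). 1 \<le> i \<and> i < j \<and> j \<le> m}. edges_between G (V i) (V j))"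


definition adj_in :: "'a ugraph \<Rightarrow> 'a set \<Rightarrow> ('a \<times> 'a) set" where
  "adj_in G V = {(u, v). u \<in> V \<and> v \<in> V \<and> {u, v} \<in> edges G}"

lemma path_imp_rtrancl:
  assumes "is_path G u p v" "set p \<subseteq> V"
  shows "(u, v) \<in> (adj_in G V)\<^sup>*"
proof -
  have "p \<noteq> [] \<Longrightarrow> set p \<subseteq> V \<Longrightarrow> successively (\<lambda>x y. {x, y} \<in> edges G) p
        \<Longrightarrow> (hd p, last p) \<in> (adj_in G V)\<^sup>*" for p
  proof (induction p)
    case (Cons a p)
    show ?case
    proof (cases "p = []")
      case False
      then have "(a, hd p) \<in> adj_in G V"
        using Cons.prems by (cases p) (auto simp: adj_in_def)
      moreover have "(hd p, last p) \<in> (adj_in G V)\<^sup>*"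
        using Cons False by (cases p) auto
      ultimately show ?thesis using False by (simp add: converse_rtrancl_into_rtrancl)
    qed simp
  qed simp
  then show ?thesis using assms unfolding is_path_def by blast
qed

lemma rtrancl_imp_path:
  assumes "(u, v) \<in> (adj_in G V)\<^sup>*" "u \<in> V" "V \<subseteq> verts G"
  shows "\<exists>p. is_path G u p v \<and> set p \<subseteq> V"
  using assms(1)
proof (induction rule: rtrancl_induct)
  case base
  have "is_path G u [u] u \<and> set [u] \<subseteq> V" using assms(2,3) by (auto simp: is_path_def)
  then show ?case by blast
next
  case (step y z)
  then obtain p where p: "is_path G u p y" "set p \<subseteq> V" by blast
  have z: "z \<in> V" "{y, z} \<in> edges G" using step.hyps by (auto simp: adj_in_def)
  show ?case
  proof (cases "z \<in> set p")
    case True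
    then obtain xs ys where xs: "p = xs @ z # ys" by (meson split_list)
    have "successively (\<lambda>x y. {x, y} \<in> edges G) ((xs @ [z]) @ ys)"
      using p xs by (simp add: is_path_def)
    then have "successively (\<lambda>x y. {x, y} \<in> edges G) (xs @ [z])"
      unfolding successively_append_iff by blast
    then have "is_path G u (xs @ [z]) z"
      using p xs unfolding is_path_def by (cases xs) auto
    then show ?thesis using p xs by (intro exI[of _ "xs @ [z]"]) auto
  next
    case False
    then have "is_path G u (p @ [z]) z"
      using p z assms(3) unfolding is_path_def by (auto simp: successively_append_iff)
    then show ?thesis using p z by (intro exI[of _ "p @ [z]"]) auto
  qed
qed

lemma connected_in_iff_rtrancl:
  "connected_in G V \<longleftrightarrow>
     V \<noteq> {} \<and> V \<subseteq> verts G \<and> (\<forall>u\<in>V. \<forall>v\<in>V. (u, v) \<in> (adj_in G V)\<^sup>*)"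
  unfolding connected_in_def by (meson path_imp_rtrancl rtrancl_imp_path)

lemma gdist_le_1:
  assumes "u \<in> verts G" "v \<in> verts G"
  shows "gdist G u v \<le> 1 \<longleftrightarrow> u = v \<or> {u, v} \<in> edges G"
proof
  assume "gdist G u v \<le> 1"
  then have "gdist G u v < enat 2"
    using enat_ord_simps(2) one_enat_def by (metis le_less_trans one_less_numeral_iff semiring_norm(76))
  then obtain p where p: "is_path G u p v" "length p - 1 < 2"
    unfolding gdist_def by (auto simp: INF_less_iff)
  then show "u = v \<or> {u, v} \<in> edges G"
    by (cases p rule: remdups_adj.cases) (auto simp: is_path_def split: if_splits)
next
  assume a: "u = v \<or> {u, v} \<in> edges G"
  show "gdist G u v \<le> 1"
  proof (cases "u = v")
    case True
    then have "is_path G u [u] v" using assms by (simp add: is_path_def)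
    then have "gdist G u v \<le> enat (length [u] - 1)"
      unfolding gdist_def by (intro INF_lower) simp
    then show ?thesis by (simp add: one_enat_def) (metis enat_0 enat_ord_simps(1) le_zero_eq zero_le)
  next
    case False
    then have "is_path G u [u, v] v" using assms a by (simp add: is_path_def)
    then have "gdist G u v \<le> enat (length [u, v] - 1)"
      unfolding gdist_def by (intro INF_lower) simp
    then show ?thesis by (simp add: one_enat_def)
  qed
qed

lemma gsetdist_gt_1:
  assumes "A \<subseteq> verts G" "B \<subseteq> verts G"
  shows "gsetdist G A B > 1 \<longleftrightarrow> (\<forall>u\<in>A. \<forall>v\<in>B. u \<noteq> v \<and> {u, v} \<notin> edges G)"
proof -
  have gt: "x > 1 \<longleftrightarrow> x \<ge> 2" for x :: enat
    by (cases x) (auto simp: one_enat_def numeral_eq_enat)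
  have "gsetdist G A B > 1 \<longleftrightarrow> (\<forall>u\<in>A. \<forall>v\<in>B. gdist G u v > 1)"
    unfolding gt gsetdist_def by (simp add: le_INF_iff)
  also have "\<dots> \<longleftrightarrow> (\<forall>u\<in>A. \<forall>v\<in>B. u \<noteq> v \<and> {u, v} \<notin> edges G)"
    using assms gdist_le_1[of _ G] by (meson linorder_not_le subsetD)
  finally show ?thesis .
qed

lemma is_decomposition_iff:
  assumes "V \<subseteq> verts G"
  shows "is_decomposition G V P \<longleftrightarrow> P = V // ((adj_in G V)\<^sup>* \<inter> V \<times> V)"
proof -
  define S where "S = (adj_in G V)\<^sup>* \<inter> V \<times> V"
  have symr: "sym ((adj_in G V)\<^sup>*)"
    by (rule sym_rtrancl) (auto simp: sym_def adj_in_def insert_commute)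
  have eq: "equiv V S"
    unfolding S_def
    by (rule equivI)
      (use symr in \<open>auto simp: refl_on_def sym_def trans_def intro: rtrancl_trans\<close>)
  have step: "(x, y) \<in> S \<Longrightarrow> (y, z) \<in> adj_in G V \<Longrightarrow> (x, z) \<in> S" for x y z
    unfolding S_def by (auto simp: adj_in_def intro: rtrancl_into_rtrancl)
  have dec: "is_decomposition G V (V // S)"
    unfolding is_decomposition_def
  proof (intro conjI ballI impI)
    show "\<Union> (V // S) = V" using eq by (rule Union_quotient)
  next
    fix A assume A: "A \<in> V // S"
    then obtain x where x: "x \<in> V" "A = S `` {x}" by (auto elim: quotientE)
    have AV: "A \<subseteq> V" using x by (auto simp: S_def)
    have "(x, y) \<in> (adj_in G A)\<^sup>*" if "(x, y) \<in> (adj_in G V)\<^sup>*" for y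
      using that
    proof (induction rule: rtrancl_induct)
      case (step y z)
      then have "y \<in> A" "z \<in> A" using x \<open>x \<in> V\<close>
        by (auto simp: S_def adj_in_def intro: rtrancl_into_rtrancl)
      then have "(y, z) \<in> adj_in G A" using step.hyps by (simp add: adj_in_def)
      then show ?case using step.IH by (rule rtrancl_into_rtrancl[rotated])
    qed simp
    then have xy: "(x, y) \<in> (adj_in G A)\<^sup>*" if "y \<in> A" for y
      using that x by (auto simp: S_def)
    have "sym ((adj_in G A)\<^sup>*)"
      by (rule sym_rtrancl) (auto simp: sym_def adj_in_def insert_commute)
    then have "(u, v) \<in> (adj_in G A)\<^sup>*" if "u \<in> A" "v \<in> A" for u v
      using xy[OF that(1)] xy[OF that(2)] by (meson rtrancl_trans symD)
    moreover have "x \<in> A" using x by (auto simp: S_def)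
    ultimately show "connected_in G A"
      using AV assms by (auto simp: connected_in_iff_rtrancl)
  next
    fix A B assume AB: "A \<in> V // S" "B \<in> V // S" "A \<noteq> B"
    have sub: "A \<subseteq> V" "B \<subseteq> V"
      using AB Union_quotient[OF eq] by blast+
    have "\<not> (u = v \<or> {u, v} \<in> edges G)" if "u \<in> A" "v \<in> B" for u v
    proof
      assume "u = v \<or> {u, v} \<in> edges G"
      then have "(u, v) \<in> S" using that sub by (auto simp: S_def adj_in_def)
      then show False using quotient_eqI[OF eq AB(1,2) that] AB(3) by blast
    qed
    then show "1 < gsetdist G A B"
      using gsetdist_gt_1[of A G B] sub assms by blast
  qed
  have "P = V // S" if P: "is_decomposition G V P"
  proof -
    have cls: "C = S `` {x}" if C: "C \<in> P" "x \<in> C" for C x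
    proof
      have CV: "C \<subseteq> V" using P C by (auto simp: is_decomposition_def)
      have "connected_in G C" using P C by (auto simp: is_decomposition_def)
      moreover have "(adj_in G C)\<^sup>* \<subseteq> (adj_in G V)\<^sup>*"
        using CV by (intro rtrancl_mono) (auto simp: adj_in_def)
      ultimately have "(x, y) \<in> (adj_in G V)\<^sup>*" if "y \<in> C" for y
        using that C unfolding connected_in_iff_rtrancl by blast
      then show "C \<subseteq> S `` {x}" using CV C by (auto simp: S_def)
      have "y \<in> C" if "(x, y) \<in> (adj_in G V)\<^sup>*" for y
        using that
      proof (induction rule: rtrancl_induct)
        case (step y z)
        then have z: "z \<in> V" "{y, z} \<in> edges G" by (auto simp: adj_in_def)
        then obtain D where D: "D \<in> P" "z \<in> D" using P by (auto simp: is_decomposition_def)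
        have "C \<subseteq> verts G" "D \<subseteq> verts G"
          using P C D by (auto simp: is_decomposition_def connected_in_def)
        then have "\<not> gsetdist G C D > 1"
          using gsetdist_gt_1[of C G D] step.IH D z by blast
        then have "C = D" using P C D by (auto simp: is_decomposition_def)
        then show ?case using D by simp
      qed (use C in simp)
      then show "S `` {x} \<subseteq> C" by (auto simp: S_def)
    qed
    have ne: "C \<noteq> {}" if "C \<in> P" for C
      using P that by (auto simp: is_decomposition_def connected_in_def)
    have un: "\<Union> P = V" using P by (simp add: is_decomposition_def)
    show ?thesis
    proof (intro equalityI subsetI)
      fix C assume C: "C \<in> P"
      then obtain x where "x \<in> C" using ne by blast
      then show "C \<in> V // S" using cls[OF C] C un by (auto intro!: quotientI)
    next
      fix C assume "C \<in> V // S"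
      then obtain x where x: "x \<in> V" "C = S `` {x}" by (auto elim: quotientE)
      then obtain D where "D \<in> P" "x \<in> D" using un by blast
      then show "C \<in> P" using cls x by metis
    qed
  qed
  then show ?thesis using dec unfolding S_def by blast
qed

lemma ex1_decomposition:
  assumes "V \<subseteq> verts G"
  shows "\<exists>!P. is_decomposition G V P"
  using is_decomposition_iff[OF assms] by simp

lemma is_decomposition_decomposition:
  assumes "V \<subseteq> verts G"
  shows "is_decomposition G V (decomposition G V)"
  unfolding decomposition_def by (rule theI'[OF ex1_decomposition[OF assms]])

lemma H_connected:
  assumes "connected_in G V"
  shows "H G V = card (spanning_trees (induced G V))"
proof -
  have "is_decomposition G V {V}" using assms by (simp add: is_decomposition_def)
  moreover have "V \<subseteq> verts G" using assms by (simp add: connected_in_def)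
  ultimately have "decomposition G V = {V}"
    using ex1_decomposition is_decomposition_decomposition by blast
  then show ?thesis by (simp add: H_def)
qed

end

theory Submission
  imports Defs
begin

text \<open>\<open>H G V\<close> counts the bases of the graphic matroid of the induced edge set on \<open>V\<close>, that is its
  maximal forests, and this count is multiplicative over vertex-disjoint unions. Hence
  \<open>\<Prod>i. H G (V i)\<close> counts the maximal forests of the edges inside the \<open>V i\<close>, and the edge set of
  the union arises by adding at most \<open>b\<close> crossing edges one at a time. Adding an edge to an edge
  set \<open>E\<close> never decreases the number of bases, and by the exchange property it multiplies it by
  at most \<open>1 + card E\<close>, which is at most \<open>2 * n ^ 2\<close> for \<open>n\<close> vertices.\<close>

section \<open>Maximal forests of an edge set\<close>

text \<open>The edge set of the complete graph on \<open>S\<close>. Writing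
  \<open>E \<subseteq> pairs S\<close> below says that \<open>E\<close> is loop-free and lives on
  the vertices \<open>S\<close>.\<close>

definition pairs :: "'a set \<Rightarrow> 'a set set" where
  "pairs S = {{u, v} | u v. u \<in> S \<and> v \<in> S \<and> u \<noteq> v}"

text \<open>Connectivity depends on the edge set alone: the closure is reflexive on the whole type,
  so no vertex set has to be carried along.\<close>

definition reach :: "'a set set \<Rightarrow> ('a \<times> 'a) set" where
  "reach F = {(u, v). {u, v} \<in> F}\<^sup>*"

text \<open>Acyclicity in the form that every edge is a bridge, which avoids cycles as lists. The
  case \<open>u = v\<close> rules out singleton edges.\<close>

definition forest :: "'a set set \<Rightarrow> bool" where
  "forest F \<longleftrightarrow> (\<forall>u v. {u, v} \<in> F \<longrightarrow> (u, v) \<notin> reach (F - {{u, v}}))"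

text \<open>Maximality is encoded as spanning: \<open>F\<close> and \<open>E\<close> have the same
  \<open>reach\<close>. In the exchange arguments this is easier to check than maximality under
  inclusion.\<close>

definition max_forests :: "'a set set \<Rightarrow> 'a set set set" where
  "max_forests E = {F. F \<subseteq> E \<and> forest F \<and> (\<forall>u v. {u, v} \<in> E \<longrightarrow> (u, v) \<in> reach F)}"

lemma pairsE:
  assumes "e \<in> pairs S"
  obtains u v where "e = {u, v}" "u \<in> S" "v \<in> S" "u \<noteq> v"
  using assms unfolding pairs_def by blast

lemma doubleton_in_pairs [simp]: "{u, v} \<in> pairs S \<longleftrightarrow> u \<in> S \<and> v \<in> S \<and> u \<noteq> v"
  unfolding pairs_def by (auto simp: doubleton_eq_iff)

lemma pairs_mono: "S \<subseteq> T \<Longrightarrow> pairs S \<subseteq> pairs T"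
  by (auto elim!: pairsE)

lemma pairs_disjoint: "S \<inter> T = {} \<Longrightarrow> pairs S \<inter> pairs T = {}"
  by (auto elim!: pairsE simp: doubleton_eq_iff)

lemma finite_pairs: "finite S \<Longrightarrow> finite (pairs S)"
  by (rule finite_subset[of _ "Pow S"]) (auto elim!: pairsE)

lemma finite_ugraph_iff: "finite_ugraph G \<longleftrightarrow> finite (verts G) \<and> edges G \<subseteq> pairs (verts G)"
  by (simp add: finite_ugraph_def pairs_def)

lemma reach_refl [simp]: "(x, x) \<in> reach F"
  by (simp add: reach_def)

lemma reach_edge: "{x, y} \<in> F \<Longrightarrow> (x, y) \<in> reach F"
  by (auto simp: reach_def)

lemma reach_trans: "(x, y) \<in> reach F \<Longrightarrow> (y, z) \<in> reach F \<Longrightarrow> (x, z) \<in> reach F"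
  unfolding reach_def by (rule rtrancl_trans)

lemma reach_sym: "(x, y) \<in> reach F \<Longrightarrow> (y, x) \<in> reach F"
proof -
  have "sym (reach F)"
    unfolding reach_def by (rule sym_rtrancl) (auto simp: sym_def insert_commute)
  then show "(x, y) \<in> reach F \<Longrightarrow> (y, x) \<in> reach F" by (rule symD)
qed

lemma reach_subset:
  assumes "\<And>u v. {u, v} \<in> E \<Longrightarrow> (u, v) \<in> reach F"
  shows "reach E \<subseteq> reach F"
  unfolding reach_def
  by (rule rtrancl_subset_rtrancl) (use assms in \<open>auto simp: reach_def\<close>)

lemma reach_mono: "E \<subseteq> F \<Longrightarrow> reach E \<subseteq> reach F"
  by (rule reach_subset) (auto intro: reach_edge)

text \<open>One passage through the new edge, in either direction, is enough: a walk that passes it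
  again returns to an endpoint visited before and can be shortened.\<close>

lemma reach_insert:
  "(x, y) \<in> reach (insert {u, v} F) \<longleftrightarrow>
     (x, y) \<in> reach F \<or> (x, u) \<in> reach F \<and> (v, y) \<in> reach F \<or> (x, v) \<in> reach F \<and> (u, y) \<in> reach F"
  (is "?L \<longleftrightarrow> ?R")
proof
  assume ?L
  then show ?R
    unfolding reach_def[of "insert _ _"]
  proof (induction rule: rtrancl_induct)
    case (step y z)
    from step.hyps(2) consider "{y, z} \<in> F" | "y = u" "z = v" | "y = v" "z = u"
      by (auto simp: doubleton_eq_iff)
    then show ?case
      using step.IH by cases (meson reach_edge reach_refl reach_trans reach_sym)+
  qed simp
next
  have "(u, v) \<in> reach (insert {u, v} F)" by (rule reach_edge) simp
  moreover have "reach F \<subseteq> reach (insert {u, v} F)" by (rule reach_mono) auto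
  moreover assume ?R
  ultimately show ?L by (meson reach_sym reach_trans subsetD)
qed

lemma forest_subset: "forest F \<Longrightarrow> F' \<subseteq> F \<Longrightarrow> forest F'"
  unfolding forest_def using reach_mono[OF Diff_mono[OF _ order_refl], of F' F] by blast

text \<open>The new edge joins two different components, so it is a bridge, and it cannot put an old
  edge on a cycle.\<close>

lemma forest_insert:
  assumes "forest F" "(u, v) \<notin> reach F"
  shows "forest (insert {u, v} F)"
  unfolding forest_def
proof (intro allI impI)
  fix x y assume xy: "{x, y} \<in> insert {u, v} F"
  have uvF: "{u, v} \<notin> F" using assms(2) reach_edge[of u v F] by blast
  show "(x, y) \<notin> reach (insert {u, v} F - {{x, y}})"
  proof (cases "{x, y} = {u, v}")
    case True
    then show ?thesis using uvF assms(2) reach_sym[of v u F] by (auto simp: doubleton_eq_iff insert_commute)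
  next
    case False
    then have F: "{x, y} \<in> F" and eq: "insert {u, v} F - {{x, y}} = insert {u, v} (F - {{x, y}})"
      using xy by auto
    have n: "(x, y) \<notin> reach (F - {{x, y}})" using assms(1) F by (simp add: forest_def)
    have m: "reach (F - {{x, y}}) \<subseteq> reach F" by (rule reach_mono) auto
    \<comment> \<open>A detour from \<open>x\<close> to \<open>y\<close> through
      \<open>{u, v}\<close>, closed up by the edge \<open>{x, y}\<close>, would join
      \<open>u\<close> and \<open>v\<close> inside \<open>F\<close>.\<close>
    show ?thesis
      unfolding eq reach_insert
      using n m reach_edge[OF F] assms(2) by (meson reach_sym reach_trans subsetD)
  qed
qed

lemma max_forests_empty: "max_forests {} = {{}}"
  by (auto simp: max_forests_def forest_def)

lemma finite_max_forests: "finite E \<Longrightarrow> finite (max_forests E)"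
  by (rule finite_subset[of _ "Pow E"]) (auto simp: max_forests_def)

section \<open>Adding edges\<close>

text \<open>If \<open>E\<close> already joins \<open>u\<close> and \<open>v\<close>, its maximal
  forests remain maximal. Otherwise the new edge is a bridge, and adding it to each of them is
  injective.\<close>

lemma card_max_forests_insert_ge:
  assumes "finite E"
  shows "card (max_forests E) \<le> card (max_forests (insert {u, v} E))"
proof (cases "(u, v) \<in> reach E")
  case True
  have "F \<in> max_forests (insert {u, v} E)" if F: "F \<in> max_forests E" for F
  proof -
    have "(u, v) \<in> reach F"
      using True F reach_subset[of E F] by (auto simp: max_forests_def)
    then show ?thesis using F reach_sym[of u v F] by (auto simp: max_forests_def doubleton_eq_iff)
  qed
  then show ?thesis using assms by (intro card_mono finite_max_forests) auto
next
  case False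
  have nE: "{u, v} \<notin> E" using False reach_edge[of u v E] by blast
  have "insert {u, v} F \<in> max_forests (insert {u, v} E)" if F: "F \<in> max_forests E" for F
  proof -
    have "(u, v) \<notin> reach F" using False F reach_mono[of F E] by (auto simp: max_forests_def)
    then show ?thesis using F forest_insert[of F u v] reach_mono[of F "insert {u, v} F"]
      by (auto simp: max_forests_def intro: reach_edge)
  qed
  moreover have "inj_on (insert {u, v}) (max_forests E)"
    by (rule inj_on_inverseI[where g = "\<lambda>F. F - {{u, v}}"]) (use nE in \<open>auto simp: max_forests_def\<close>)
  ultimately show ?thesis
    using assms by (intro card_inj_on_le[of "insert {u, v}"] finite_max_forests) auto
qed

text \<open>A bridge lies in every maximal forest, and deleting it is injective. Otherwise the
  summand 1 accounts for the forests that are already maximal in \<open>E\<close>, and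
  \<open>card E\<close> for those arising by exchanging one edge for \<open>{u, v}\<close>.\<close>

lemma card_max_forests_insert_le:
  assumes "finite E"
  shows "card (max_forests (insert {u, v} E)) \<le> card (max_forests E) * (1 + card E)"
proof (cases "(u, v) \<in> reach E")
  case False
  have *: "{u, v} \<in> F \<and> F - {{u, v}} \<in> max_forests E" if F: "F \<in> max_forests (insert {u, v} E)" for F
  proof -
    define D where "D = F - {{u, v}}"
    have DE: "D \<subseteq> E" using F by (auto simp: max_forests_def D_def)
    then have "(u, v) \<notin> reach D" using False reach_mono by blast
    moreover have "(u, v) \<in> reach F" using F by (auto simp: max_forests_def)
    ultimately have uvF: "{u, v} \<in> F" by (metis D_def Diff_insert0 Diff_empty)
    then have FD: "F = insert {u, v} D" by (auto simp: D_def)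
    have "(x, y) \<in> reach D" if xy: "{x, y} \<in> E" for x y
    proof -
      have "(x, y) \<in> reach (insert {u, v} D)" using F xy FD by (auto simp: max_forests_def)
      moreover have "reach D \<subseteq> reach E" using DE by (rule reach_mono)
      ultimately show ?thesis unfolding reach_insert
        using reach_edge[OF xy] False by (meson reach_sym reach_trans subsetD)
    qed
    moreover have "forest D" using F by (auto simp: max_forests_def D_def intro: forest_subset)
    ultimately show ?thesis using DE uvF by (simp add: max_forests_def D_def)
  qed
  then have "inj_on (\<lambda>F. F - {{u, v}}) (max_forests (insert {u, v} E))"
    by (intro inj_onI) (metis insert_Diff)
  then have "card (max_forests (insert {u, v} E)) \<le> card (max_forests E)"
    using * assms by (intro card_inj_on_le[of "\<lambda>F. F - {{u, v}}"] finite_max_forests) auto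
  then show ?thesis by (simp add: le_trans trans_le_add1)
next
  case True
  \<comment> \<open>The exchange map: from a maximal forest \<open>B\<close> of \<open>E\<close> and
    an edge \<open>f\<close>, put \<open>{u, v}\<close> in place of \<open>f\<close>. Only covering
    matters, so \<open>f\<close> need not lie in \<open>B\<close>.\<close>
  define g where "g = (\<lambda>(B, f). insert {u, v} (B - {f} :: 'a set set))"
  have "F \<in> max_forests E \<union> g ` (max_forests E \<times> E)" if F: "F \<in> max_forests (insert {u, v} E)" for F
  proof (cases "{u, v} \<in> F")
    case False
    then show ?thesis using F by (auto simp: max_forests_def)
  next
    case uvF: True
    define D where "D = F - {{u, v}}"
    have FD: "F = insert {u, v} D" using uvF by (auto simp: D_def)
    have DE: "D \<subseteq> E" using F by (auto simp: max_forests_def D_def)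
    have fD: "forest D" using F by (auto simp: max_forests_def D_def intro: forest_subset)
    have "(u, v) \<notin> reach D" using F uvF by (auto simp: max_forests_def D_def forest_def)
    \<comment> \<open>\<open>E\<close> joins \<open>u\<close> and \<open>v\<close> but
      \<open>D\<close> does not, so some edge of \<open>E\<close> runs between different components
      of \<open>D\<close>. It replaces \<open>{u, v}\<close> in \<open>B\<close>.\<close>
    then obtain x y where xy: "{x, y} \<in> E" "(x, y) \<notin> reach D"
      using True reach_subset[of E D] by blast
    define B where "B = insert {x, y} D"
    have "(x, y) \<in> reach (insert {u, v} D)" using F xy FD by (auto simp: max_forests_def)
    \<comment> \<open>The connection from \<open>x\<close> to \<open>y\<close> in \<open>F\<close>
      must pass through \<open>{u, v}\<close>; its remaining pieces in \<open>D\<close>, together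
      with the edge \<open>{x, y}\<close>, join \<open>u\<close> and \<open>v\<close>.\<close>
    then have uvB: "(u, v) \<in> reach B"
      using xy(2) unfolding reach_insert B_def by (meson reach_sym)
    have "reach F \<subseteq> reach B"
    proof (rule reach_subset)
      fix a c assume ac: "{a, c} \<in> F"
      show "(a, c) \<in> reach B"
      proof (cases "{a, c} = {u, v}")
        case True
        then show ?thesis using uvB reach_sym by (auto simp: doubleton_eq_iff)
      next
        case False
        then show ?thesis using ac by (auto simp: B_def D_def intro!: reach_edge)
      qed
    qed
    moreover have "forest B" unfolding B_def using fD xy(2) by (rule forest_insert)
    ultimately have "B \<in> max_forests E"
      using F DE xy(1) by (auto simp: max_forests_def B_def)
    moreover have "{x, y} \<notin> D" using xy(2) reach_edge[of x y D] by blast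
    then have "F = g (B, {x, y})" by (auto simp: g_def FD B_def)
    ultimately show ?thesis using xy(1) by blast
  qed
  then have "card (max_forests (insert {u, v} E)) \<le> card (max_forests E \<union> g ` (max_forests E \<times> E))"
    using assms by (intro card_mono) (auto intro: finite_max_forests)
  also have "\<dots> \<le> card (max_forests E) + card (g ` (max_forests E \<times> E))"
    by (rule card_Un_le)
  also have "\<dots> \<le> card (max_forests E) + card (max_forests E) * card E"
    using card_image_le[of "max_forests E \<times> E" g] finite_max_forests[OF assms] assms
    by (simp add: card_cartesian_product)
  finally show ?thesis by simp
qed

text \<open>Both one-edge bounds are iterated over \<open>K\<close>. The factor at each stage
  depends on the current number of edges.\<close>

lemma card_max_forests_Un:
  assumes "finite K" "finite A" "K \<subseteq> pairs S"
  shows "card (max_forests A) \<le> card (max_forests (A \<union> K)) \<and>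
    card (max_forests (A \<union> K)) \<le> card (max_forests A) * (1 + card (A \<union> K)) ^ card K"
  using assms(1,3)
proof (induction K)
  case (insert e K)
  then obtain u v where e: "e = {u, v}" by (auto elim: pairsE)
  have fin: "finite (A \<union> K)" using insert assms by simp
  have IH: "card (max_forests A) \<le> card (max_forests (A \<union> K))"
    "card (max_forests (A \<union> K)) \<le> card (max_forests A) * (1 + card (A \<union> K)) ^ card K"
    using insert by auto
  have le: "card (A \<union> K) \<le> card (A \<union> insert e K)"
    using fin by (intro card_mono) auto
  have "card (max_forests (insert e (A \<union> K))) \<le> card (max_forests (A \<union> K)) * (1 + card (A \<union> K))"
    using card_max_forests_insert_le[OF fin] e by simp
  also have "\<dots> \<le> (card (max_forests A) * (1 + card (A \<union> K)) ^ card K) * (1 + card (A \<union> K))"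
    using IH(2) by (rule mult_right_mono) simp
  also have "\<dots> = card (max_forests A) * (1 + card (A \<union> K)) ^ card (insert e K)"
    using insert.hyps by (simp add: algebra_simps)
  \<comment> \<open>All stages are charged the factor of the final, largest edge set, which turns
    the product into a power.\<close>
  also have "\<dots> \<le> card (max_forests A) * (1 + card (A \<union> insert e K)) ^ card (insert e K)"
    using le by (intro mult_left_mono power_mono) auto
  finally have "card (max_forests (A \<union> insert e K)) \<le>
    card (max_forests A) * (1 + card (A \<union> insert e K)) ^ card (insert e K)" by simp
  moreover have "card (max_forests A) \<le> card (max_forests (A \<union> insert e K))"
    using card_max_forests_insert_ge[OF fin, of u v] IH(1) e by simp
  ultimately show ?case by blast
qed simp

section \<open>Vertex-disjoint unions\<close>

text \<open>A walk that starts in \<open>S\<close> never leaves \<open>S\<close>, since edges of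
  \<open>F'\<close> have no endpoint there. The induction therefore carries membership in
  \<open>S\<close> along.\<close>

lemma reach_Un_disjoint:
  assumes "F \<subseteq> pairs S" "F' \<subseteq> pairs S'" "S \<inter> S' = {}" "x \<in> S" "(x, y) \<in> reach (F \<union> F')"
  shows "(x, y) \<in> reach F"
proof -
  have "(x, y) \<in> reach F \<and> y \<in> S"
    using assms(5) unfolding reach_def[of "F \<union> F'"]
  proof (induction rule: rtrancl_induct)
    case (step y z)
    then have "{y, z} \<notin> F'" using assms(2,3) doubleton_in_pairs[of y z S'] by blast
    then have "{y, z} \<in> F" using step.hyps by simp
    moreover from this have "z \<in> S" using assms(1) doubleton_in_pairs[of y z S] by blast
    ultimately show ?case using step.IH reach_edge[of y z F] reach_trans[of x y F z] by blast
  qed (use assms(4) in simp)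
  then show ?thesis ..
qed

lemma forest_Un_disjoint:
  assumes "F \<subseteq> pairs S" "F' \<subseteq> pairs S'" "S \<inter> S' = {}" "forest F" "forest F'"
  shows "forest (F \<union> F')"
  unfolding forest_def
proof (intro allI impI)
  \<comment> \<open>Stated for arbitrary sides, so that swapping the roles covers edges of the other
    forest.\<close>
  have *: "(u, v) \<notin> reach (F \<union> F' - {{u, v}})"
    if "F \<subseteq> pairs S" "F' \<subseteq> pairs S'" "S \<inter> S' = {}" "forest F" "{u, v} \<in> F"
    for F F' :: "'a set set" and S S' u v
  proof
    assume "(u, v) \<in> reach (F \<union> F' - {{u, v}})"
    then have "(u, v) \<in> reach ((F - {{u, v}}) \<union> (F' - {{u, v}}))" by (simp add: Un_Diff)
    moreover have "u \<in> S" using that(1,5) doubleton_in_pairs[of u v S] by blast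
    moreover have "F - {{u, v}} \<subseteq> pairs S" "F' - {{u, v}} \<subseteq> pairs S'" using that(1,2) by auto
    ultimately have "(u, v) \<in> reach (F - {{u, v}})"
      using reach_Un_disjoint[OF _ _ that(3)] by metis
    then show False using that(4,5) by (simp add: forest_def)
  qed
  fix u v assume "{u, v} \<in> F \<union> F'"
  then show "(u, v) \<notin> reach (F \<union> F' - {{u, v}})"
    using *[of F S F' S' u v] *[of F' S' F S u v] assms by (auto simp: Un_commute Int_commute)
qed

text \<open>Union of forests is a bijection from pairs of maximal forests, with inverse given by
  intersecting with \<open>E\<close> and \<open>E'\<close>.\<close>

lemma card_max_forests_Un_disjoint:
  assumes E: "E \<subseteq> pairs S" and E': "E' \<subseteq> pairs S'" and S: "S \<inter> S' = {}"
  shows "card (max_forests (E \<union> E')) = card (max_forests E) * card (max_forests E')"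
proof -
  have disj: "E \<inter> E' = {}" using E E' pairs_disjoint[OF S] by blast
  have restrict: "F \<inter> E \<in> max_forests E"
    if "E \<subseteq> pairs S" "E' \<subseteq> pairs S'" "S \<inter> S' = {}" "F \<in> max_forests (E \<union> E')"
    for F E E' :: "'a set set" and S S'
  proof -
    have F: "F = (F \<inter> E) \<union> (F \<inter> E')" using that(4) by (auto simp: max_forests_def)
    have sub: "F \<inter> E \<subseteq> pairs S" "F \<inter> E' \<subseteq> pairs S'"
      using that(1,2) by auto
    have "(u, v) \<in> reach (F \<inter> E)" if uv: "{u, v} \<in> E" for u v
    proof (rule reach_Un_disjoint[OF sub])
      show "S \<inter> S' = {}" by fact
      show "u \<in> S" using uv \<open>E \<subseteq> pairs S\<close> doubleton_in_pairs[of u v S] by blast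
      have "(u, v) \<in> reach F" using uv \<open>F \<in> max_forests (E \<union> E')\<close> by (simp add: max_forests_def)
      then show "(u, v) \<in> reach ((F \<inter> E) \<union> (F \<inter> E'))" by (subst F[symmetric])
    qed
    then show ?thesis
      using that(4) forest_subset[of F "F \<inter> E"] by (auto simp: max_forests_def)
  qed
  have "bij_betw (\<lambda>(F, F'). F \<union> F') (max_forests E \<times> max_forests E') (max_forests (E \<union> E'))"
  proof (rule bij_betw_byWitness[where f' = "\<lambda>F. (F \<inter> E, F \<inter> E')"])
    show "\<forall>p\<in>max_forests E \<times> max_forests E'.
        ((case p of (F, F') \<Rightarrow> F \<union> F') \<inter> E, (case p of (F, F') \<Rightarrow> F \<union> F') \<inter> E') = p"
      using disj by (auto simp: max_forests_def)
    show "\<forall>F\<in>max_forests (E \<union> E'). (case (F \<inter> E, F \<inter> E') of (F, F') \<Rightarrow> F \<union> F') = F"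
      by (auto simp: max_forests_def)
    show "(\<lambda>(F, F'). F \<union> F') ` (max_forests E \<times> max_forests E') \<subseteq> max_forests (E \<union> E')"
    proof clarify
      fix F F' assume FF: "F \<in> max_forests E" "F' \<in> max_forests E'"
      have "forest (F \<union> F')"
        by (rule forest_Un_disjoint[OF _ _ S]) (use FF E E' in \<open>auto simp: max_forests_def\<close>)
      moreover have "reach F \<subseteq> reach (F \<union> F')" "reach F' \<subseteq> reach (F \<union> F')"
        by (auto intro!: reach_mono)
      ultimately show "F \<union> F' \<in> max_forests (E \<union> E')"
        using FF by (auto simp: max_forests_def)
    qed
    show "(\<lambda>F. (F \<inter> E, F \<inter> E')) ` max_forests (E \<union> E') \<subseteq> max_forests E \<times> max_forests E'"
      using restrict[OF E E' S] restrict[OF E' E] S by (auto simp: Un_commute Int_commute)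
  qed
  from bij_betw_same_card[OF this] show ?thesis by (simp add: card_cartesian_product)
qed

lemma card_max_forests_UN_disjoint:
  assumes "finite I" "\<And>i. i \<in> I \<Longrightarrow> E i \<subseteq> pairs (S i)"
    "\<And>i j. i \<in> I \<Longrightarrow> j \<in> I \<Longrightarrow> i \<noteq> j \<Longrightarrow> S i \<inter> S j = {}"
  shows "card (max_forests (\<Union>i\<in>I. E i)) = (\<Prod>i\<in>I. card (max_forests (E i)))"
  using assms
proof (induction I)
  case empty
  show ?case by (simp add: max_forests_empty)
next
  case (insert i I)
  have "card (max_forests (E i \<union> (\<Union>j\<in>I. E j))) =
      card (max_forests (E i)) * card (max_forests (\<Union>j\<in>I. E j))"
  proof (rule card_max_forests_Un_disjoint)
    show "E i \<subseteq> pairs (S i)" using insert.prems by simp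
    show "(\<Union>j\<in>I. E j) \<subseteq> pairs (\<Union>j\<in>I. S j)"
    proof (rule UN_least)
      fix j assume "j \<in> I"
      then show "E j \<subseteq> pairs (\<Union>j\<in>I. S j)"
        using insert.prems(1)[of j] pairs_mono[of "S j" "\<Union>j\<in>I. S j"] by blast
    qed
    show "S i \<inter> (\<Union>j\<in>I. S j) = {}" using insert.prems(2) insert.hyps(2) by fastforce
  qed
  then show ?case using insert by simp
qed

section \<open>Spanning trees\<close>

text \<open>Connects the path lemmas for \<open>adj_in\<close> with \<open>reach\<close>: edges in
  \<open>pairs C\<close> have both endpoints in \<open>C\<close>, so the restriction to
  \<open>C\<close> is automatic.\<close>

lemma rtrancl_adj_in:
  assumes "F \<subseteq> pairs C"
  shows "(adj_in (C, F) C)\<^sup>* = reach F"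
proof -
  have "adj_in (C, F) C = {(u, v). {u, v} \<in> F}"
    unfolding adj_in_def using assms doubleton_in_pairs[of _ _ C] by auto
  then show ?thesis by (simp add: reach_def)
qed

text \<open>Removing the closing edge of a cycle leaves a path between its endpoints, so that edge
  is no bridge; conversely, a path around an edge closes to a cycle.\<close>

lemma no_cycle_iff_forest:
  assumes F: "F \<subseteq> pairs C"
  shows "(\<nexists>p. is_cycle (C, F) p) \<longleftrightarrow> forest F"
proof
  assume nc: "\<nexists>p. is_cycle (C, F) p"
  show "forest F"
    unfolding forest_def
  proof (intro allI impI notI)
    fix u v assume uv: "{u, v} \<in> F" and r: "(u, v) \<in> reach (F - {{u, v}})"
    have "u \<in> C" "u \<noteq> v" using F uv doubleton_in_pairs[of u v C] by blast+
    moreover have "(u, v) \<in> (adj_in (C, F - {{u, v}}) C)\<^sup>*"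
      using r F by (subst rtrancl_adj_in) auto
    ultimately obtain p where p: "is_path (C, F - {{u, v}}) u p v"
      using rtrancl_imp_path[of u v "(C, F - {{u, v}})" C] by auto
    \<comment> \<open>A path with only two vertices would be the deleted edge \<open>{u, v}\<close>
      itself.\<close>
    have "length p \<ge> 3"
      using p \<open>u \<noteq> v\<close> by (cases p rule: remdups_adj.cases; cases "tl (tl p)") (auto simp: is_path_def)
    moreover have "is_path (C, F) u p v"
      using p by (auto simp: is_path_def elim: successively_mono)
    ultimately have "is_cycle (C, F) p"
      using uv by (auto simp: is_cycle_def is_path_def insert_commute)
    then show False using nc by blast
  qed
next
  assume f: "forest F"
  show "\<nexists>p. is_cycle (C, F) p"
  proof
    assume "\<exists>p. is_cycle (C, F) p"
    then obtain p where len: "length p \<ge> 3" and p: "is_path (C, F) (hd p) p (last p)"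
      and e: "{last p, hd p} \<in> F" by (auto simp: is_cycle_def)
    have d: "distinct p" using p by (simp add: is_path_def)
    have "p \<noteq> []" using len by auto
    then have hl: "hd p = p ! 0" "last p = p ! (length p - 1)"
      by (auto simp: hd_conv_nth last_conv_nth)
    \<comment> \<open>With distinct vertices, neighbouring positions could be the first and the last
      only in a list of length 2.\<close>
    have "{p ! i, p ! Suc i} \<noteq> {hd p, last p}" if i: "Suc i < length p" for i
      using i d len \<open>p \<noteq> []\<close> unfolding hl doubleton_eq_iff
      by (simp add: nth_eq_iff_index_eq) linarith
    then have "is_path (C, F - {{hd p, last p}}) (hd p) p (last p)"
      using p by (auto simp: is_path_def successively_conv_nth)
    then have "(hd p, last p) \<in> (adj_in (C, F - {{hd p, last p}}) C)\<^sup>*"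
      by (rule path_imp_rtrancl) (use p in \<open>simp add: is_path_def\<close>)
    then have "(hd p, last p) \<in> reach (F - {{hd p, last p}})"
      using F by (subst (asm) rtrancl_adj_in) auto
    moreover have "{hd p, last p} \<in> F" using e by (simp add: insert_commute)
    ultimately show False using f unfolding forest_def by blast
  qed
qed

lemma edges_induced_pairs:
  assumes "finite_ugraph G"
  shows "edges (induced G V) \<subseteq> pairs V"
proof
  fix e assume e: "e \<in> edges (induced G V)"
  then have "e \<in> pairs (verts G)" using assms by (auto simp: finite_ugraph_iff induced_def)
  then show "e \<in> pairs V" using e by (auto simp: induced_def elim!: pairsE)
qed

text \<open>The vertex set of a spanning tree is fixed to be \<open>C\<close>, so the tree is
  determined by its edges, and these are exactly the maximal forests.\<close>

lemma card_spanning_trees_induced: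
  assumes G: "finite_ugraph G" and C: "connected_in G C"
  shows "card (spanning_trees (induced G C)) = card (max_forests (edges (induced G C)))"
proof -
  define E where "E = edges (induced G C)"
  have EC: "E \<subseteq> pairs C" unfolding E_def using G by (rule edges_induced_pairs)
  have CG: "C \<noteq> {}" "C \<subseteq> verts G" "finite C"
    using C G by (auto simp: connected_in_def finite_ugraph_def intro: finite_subset)
  have "(adj_in G C)\<^sup>* = reach E"
    using rtrancl_adj_in[OF EC] by (simp add: adj_in_def E_def induced_def conj_commute cong: conj_cong)
  then have all: "(u, v) \<in> reach E" if "u \<in> C" "v \<in> C" for u v
    using C that by (simp add: connected_in_iff_rtrancl)
  have "is_tree (C, F) \<longleftrightarrow> forest F \<and> (\<forall>u v. {u, v} \<in> E \<longrightarrow> (u, v) \<in> reach F)" if "F \<subseteq> E" for F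
  proof -
    have FC: "F \<subseteq> pairs C" using that EC by simp
    have "connected_in (C, F) C \<longleftrightarrow> (\<forall>u\<in>C. \<forall>v\<in>C. (u, v) \<in> reach F)"
      using CG rtrancl_adj_in[OF FC] by (simp add: connected_in_iff_rtrancl)
    also have "\<dots> \<longleftrightarrow> (\<forall>u v. {u, v} \<in> E \<longrightarrow> (u, v) \<in> reach F)"
    proof
      assume "\<forall>u\<in>C. \<forall>v\<in>C. (u, v) \<in> reach F"
      then show "\<forall>u v. {u, v} \<in> E \<longrightarrow> (u, v) \<in> reach F"
        using EC doubleton_in_pairs[of _ _ C] by blast
    next
      assume "\<forall>u v. {u, v} \<in> E \<longrightarrow> (u, v) \<in> reach F"
      \<comment> \<open>Since \<open>C\<close> is connected, \<open>E\<close> joins all of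
        \<open>C\<close>; hence joining the endpoints of each edge of \<open>E\<close> already joins
        all of \<open>C\<close>.\<close>
      then have "reach E \<subseteq> reach F" by (intro reach_subset) auto
      then show "\<forall>u\<in>C. \<forall>v\<in>C. (u, v) \<in> reach F" using all by blast
    qed
    finally show ?thesis
      using no_cycle_iff_forest[OF FC] FC CG(3) by (auto simp: is_tree_def finite_ugraph_iff)
  qed
  then have tree: "{F. F \<subseteq> E \<and> is_tree (C, F)} = max_forests E"
    unfolding max_forests_def by blast
  have "spanning_trees (induced G C) = Pair C ` {F. F \<subseteq> E \<and> is_tree (C, F)}"
    unfolding spanning_trees_def E_def by (auto simp: induced_def image_iff)
  then have "spanning_trees (induced G C) = Pair C ` max_forests E"
    unfolding tree .
  then show ?thesis by (simp add: card_image inj_on_def E_def)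
qed

text \<open>No edge runs between two parts of the decomposition, so the induced edges split into
  vertex-disjoint pieces and the product over the parts becomes a single count.\<close>

lemma H_eq_card_max_forests:
  assumes G: "finite_ugraph G" and V: "V \<subseteq> verts G"
  shows "H G V = card (max_forests (edges (induced G V)))"
proof -
  define P where "P = decomposition G V"
  have "is_decomposition G V P" unfolding P_def using V by (rule is_decomposition_decomposition)
  then have UP: "\<Union> P = V" and con: "\<And>C. C \<in> P \<Longrightarrow> connected_in G C"
    and gd: "\<And>C D. C \<in> P \<Longrightarrow> D \<in> P \<Longrightarrow> C \<noteq> D \<Longrightarrow> gsetdist G C D > 1"
    by (auto simp: is_decomposition_def)
  have sep: "u \<noteq> v \<and> {u, v} \<notin> edges G" if "C \<in> P" "D \<in> P" "C \<noteq> D" "u \<in> C" "v \<in> D" for C D u v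
    using gd[OF that(1-3)] gsetdist_gt_1[of C G D] con that by (auto simp: connected_in_def)
  have "finite V" using G V by (auto simp: finite_ugraph_def intro: finite_subset)
  then have "finite P" using UP finite_UnionD by blast
  have "edges (induced G V) = (\<Union>C\<in>P. edges (induced G C))"
  proof
    show "edges (induced G V) \<subseteq> (\<Union>C\<in>P. edges (induced G C))"
    proof
      fix e assume e: "e \<in> edges (induced G V)"
      then obtain u v where uv: "e = {u, v}" "u \<in> V" "v \<in> V"
        using edges_induced_pairs[OF G, of V] by (meson pairsE subsetD)
      then obtain C D where CD: "C \<in> P" "D \<in> P" "u \<in> C" "v \<in> D" using UP by blast
      then have "C = D" using sep[OF CD(1,2) _ CD(3,4)] e uv by (auto simp: induced_def)
      then show "e \<in> (\<Union>C\<in>P. edges (induced G C))" using CD e uv by (auto simp: induced_def)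
    qed
  qed (use UP in \<open>auto simp: induced_def\<close>)
  moreover have "card (max_forests (\<Union>C\<in>P. edges (induced G C))) =
      (\<Prod>C\<in>P. card (max_forests (edges (induced G C))))"
    by (rule card_max_forests_UN_disjoint[OF \<open>finite P\<close> edges_induced_pairs[OF G]]) (use sep in blast)
  ultimately show ?thesis
    unfolding H_def P_def[symmetric] using card_spanning_trees_induced[OF G con] by simp
qed

section \<open>The comparison\<close>

text \<open>Ordered pairs of vertices cover the edges. This crude bound is enough, because the
  target factor is twice the square of the number of vertices.\<close>

lemma card_pairs_subset_le:
  assumes "finite W" "E \<subseteq> pairs W"
  shows "card E \<le> card W ^ 2"
proof -
  have "E \<subseteq> (\<lambda>(u, v). {u, v}) ` (W \<times> W)" using assms(2) by (auto simp: pairs_def)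
  then have "card E \<le> card (W \<times> W)" by (rule surj_card_le[rotated]) (use assms(1) in simp)
  then show ?thesis by (simp add: card_cartesian_product power2_eq_square)
qed

lemma card_crossing_edges_le_b:
  assumes G: "finite_ugraph G"
  shows "card (edges (induced G (\<Union>i\<in>{1..m}. V i)) - (\<Union>i\<in>{1..m}. edges (induced G (V i)))) \<le> b G m V"
    (is "card ?K \<le> _")
proof -
  define J where "J = {(i, j). 1 \<le> i \<and> i < j \<and> j \<le> m}"
  define Q where "Q = (\<lambda>(i, j). {e \<in> edges G. \<exists>u\<in>V i. \<exists>v\<in>V j. e = {u, v}})"
  have finE: "finite (edges G)"
    using G finite_pairs finite_subset unfolding finite_ugraph_iff by blast
  have finJ: "finite J" by (rule finite_subset[of _ "{1..m} \<times> {1..m}"]) (auto simp: J_def)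
  have "?K \<subseteq> (\<Union>p\<in>J. Q p)"
  proof
    fix e assume e: "e \<in> ?K"
    then have eG: "e \<in> edges G" by (simp add: induced_def)
    obtain u v where uv: "e = {u, v}" "u \<in> (\<Union>i\<in>{1..m}. V i)" "v \<in> (\<Union>i\<in>{1..m}. V i)"
      using e edges_induced_pairs[OF G] by (meson DiffD1 pairsE subsetD)
    then obtain i j where ij: "i \<in> {1..m}" "j \<in> {1..m}" "u \<in> V i" "v \<in> V j" by blast
    \<comment> \<open>An edge with both ends in one \<open>V i\<close> was removed from the crossing
      edges. Ordering the two indices then matches the index set of \<open>b\<close>.\<close>
    have "i \<noteq> j" using e ij uv(1) by (auto simp: induced_def)
    then consider "(i, j) \<in> J" | "(j, i) \<in> J" using ij by (force simp: J_def)
    then show "e \<in> (\<Union>p\<in>J. Q p)"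
    proof cases
      case 1
      have "e \<in> Q (i, j)" using eG uv(1) ij by (auto simp: Q_def)
      then show ?thesis using 1 by blast
    next
      case 2
      have "e \<in> Q (j, i)" using eG uv(1) ij by (auto simp: Q_def insert_commute)
      then show ?thesis using 2 by blast
    qed
  qed
  then have "card ?K \<le> card (\<Union>p\<in>J. Q p)"
    using finE finJ by (intro card_mono) (auto simp: Q_def)
  also have "\<dots> \<le> (\<Sum>p\<in>J. card (Q p))" using finJ by (rule card_UN_le)
  also have "\<dots> = b G m V"
    unfolding b_def J_def Q_def edges_between_def by (intro sum.cong) auto
  finally show ?thesis .
qed

theorem lemmaS24:
  fixes G :: "'a ugraph" and m :: nat and V :: "nat \<Rightarrow> 'a set"
  assumes "finite_ugraph G"
    and "\<And>i. i \<in> {1..m} \<Longrightarrow> V i \<subseteq> verts G"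
    and "\<And>i i'. i \<in> {1..m} \<Longrightarrow> i' \<in> {1..m} \<Longrightarrow> i \<noteq> i' \<Longrightarrow> V i \<inter> V i' = {}"
  shows "real (\<Prod>i=1..m. H G (V i)) \<le> real (H G (\<Union>i\<in>{1..m}. V i)) \<and>
    real (H G (\<Union>i\<in>{1..m}. V i)) \<le>
      real (\<Prod>i=1..m. H G (V i)) *
        exp (real (b G m V) * (2 * ln (real (\<Sum>i=1..m. card (V i))) + ln 2))"
proof -
  define W where "W = (\<Union>i\<in>{1..m}. V i)"
  define n where "n = (\<Sum>i=1..m. card (V i))"
  define A where "A = (\<Union>i\<in>{1..m}. edges (induced G (V i)))"
  define E where "E = edges (induced G W)"
  \<comment> \<open>The crossing edges, which are added one by one to \<open>A\<close>.\<close>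
  define K where "K = E - A"
  have WG: "W \<subseteq> verts G" unfolding W_def using assms(2) by (rule UN_least)
  then have finW: "finite W" using assms(1) by (auto simp: finite_ugraph_def intro: finite_subset)
  then have n: "n = card W"
    unfolding n_def W_def using assms(3) by (subst card_UN_disjoint) auto
  have EW: "E \<subseteq> pairs W" unfolding E_def using assms(1) by (rule edges_induced_pairs)
  have finE: "finite E"
    using EW finite_pairs[OF finW] by (rule finite_subset)
  have AE: "A \<subseteq> E" by (auto simp: A_def E_def W_def induced_def)
  have AK: "A \<union> K = E" using AE by (auto simp: K_def)
  have "card (max_forests A) = (\<Prod>i=1..m. card (max_forests (edges (induced G (V i)))))"
    unfolding A_def
    by (rule card_max_forests_UN_disjoint[OF _ edges_induced_pairs[OF assms(1)] assms(3)]) auto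
  also have "\<dots> = (\<Prod>i=1..m. H G (V i))"
    using assms(1,2) by (intro prod.cong) (auto simp: H_eq_card_max_forests)
  finally have HA: "(\<Prod>i=1..m. H G (V i)) = card (max_forests A)" ..
  have HE: "H G W = card (max_forests E)"
    unfolding E_def using assms(1) WG by (rule H_eq_card_max_forests)
  have "finite K" "finite A" "K \<subseteq> pairs W"
    using finE AE EW by (auto simp: K_def intro: finite_subset)
  note bounds = card_max_forests_Un[OF this, unfolded AK]
  have Kb: "card K \<le> b G m V"
    unfolding K_def E_def A_def W_def using assms(1) by (rule card_crossing_edges_le_b)
  \<comment> \<open>For positive \<open>n\<close> the bracket in the exponent is the logarithm of
    \<open>2 * n ^ 2\<close>, which bounds the factor paid for each edge.\<close>
  have pow: "real ((1 + card E) ^ card K) \<le> exp (real (b G m V) * (2 * ln (real n) + ln 2))"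
  proof (cases "n = 0")
    case True
    \<comment> \<open>Here \<open>ln 0 = 0\<close>, but there are no edges at all.\<close>
    then have "E = {}" using n finW EW by (auto simp: pairs_def)
    then show ?thesis using True by (simp add: K_def)
  next
    case False
    \<comment> \<open>One copy of \<open>n ^ 2\<close> bounds \<open>card E\<close>, the other
      absorbs the 1 because \<open>n\<close> is positive.\<close>
    have "1 + card E \<le> 2 * n ^ 2"
      using card_pairs_subset_le[OF finW EW] zero_less_power[of n 2] False unfolding n by linarith
    then have "real (1 + card E) \<le> 2 * real n ^ 2"
      by (metis of_nat_le_iff of_nat_mult of_nat_numeral of_nat_power)
    then have "real (1 + card E) ^ card K \<le> (2 * real n ^ 2) ^ card K"
      by (rule power_mono) simp
    \<comment> \<open>Raising the exponent from \<open>card K\<close> to \<open>b G m V\<close> is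
      allowed because the base is at least 1.\<close>
    also have "\<dots> \<le> (2 * real n ^ 2) ^ b G m V"
      using Kb \<open>real (1 + card E) \<le> 2 * real n ^ 2\<close> by (intro power_increasing) auto
    also have "2 * real n ^ 2 = exp (2 * ln (real n) + ln 2)"
      using False by (simp add: exp_add exp_double)
    finally show ?thesis by (simp add: exp_of_nat_mult)
  qed
  have "real (card (max_forests E)) \<le> real (card (max_forests A)) * real ((1 + card E) ^ card K)"
    using bounds by (metis of_nat_le_iff of_nat_mult)
  also have "\<dots> \<le> real (card (max_forests A)) * exp (real (b G m V) * (2 * ln (real n) + ln 2))"
    using pow by (rule mult_left_mono) simp
  finally show ?thesis
    using bounds HA HE by (simp add: W_def n_def)
qed

end
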